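(* Fix positive integers $a,b,c,m$ with $\gcd(a,b)=1$ and $m\geq 2$. Then the equation $$\varphi\left(\frac{a\cdot n!}{b}\right)=cx^m$$ has only finitely many solutions in positive integers $n,x$ (with $a\cdot n!/b$ a positive integer), and every solution satisfies $n\leq\max\{61,3a,3b,3c\}$. In particular, all of the integer solutions to $\varphi(n!)=x^m$ with $m\geq 2$ and $n\geq 1$ are: $\varphi(1!)=1^m$, $\varphi(2!)=1^m$, $\varphi(4!)=2^3$, $\varphi(5!)=2^5$, $\varphi(8!)=(2^5\cdot 3)^2$, $\varphi(9!)=(2^5\cdot 3^2)^2$, $\varphi(11!)=(2^6\cdot 3^2\cdot 5)^2$, and $\varphi(13!)=(2^8\cdot 3^3\cdot 5)^2$.
   Context: $\varphi$ denotes Euler's totient function. *)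

theory Defs
  imports Complex_Main "HOL-Number_Theory.Totient"
begin

end

theory Submission
  imports Defs "HOL-Number_Theory.Prime_Powers"
begin

text \<open>
  Let \<open>n \<ge> 62\<close> and \<open>n > 3 a, 3 b, 3 c\<close>. If \<open>p \<equiv> 1 (mod 3)\<close> is a prime with \<open>2 p \<le> n < 3 p\<close>, then \<open>p\<close>
  divides \<open>a n! / b\<close> exactly twice, and no prime \<open>q \<le> n\<close> satisfies \<open>q \<equiv> 1 (mod p)\<close>: the only odd
  candidate is \<open>2 p + 1\<close>, which is divisible by 3. Hence \<open>p\<close> divides \<open>\<phi>(a n! / b)\<close> exactly once,
  which is impossible for \<open>c x\<^sup>m\<close> with \<open>m \<ge> 2\<close>.

  Such a prime exists by a Chebyshev argument. A combination of the sums of \<open>ln m\<close> over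
  \<open>m \<le> n / k\<close>, \<open>m \<equiv> r (mod 3)\<close>, is expanded in the von Mangoldt function in such a way that only the
  \<open>d \<equiv> 1 (mod 3)\<close> in \<open>(n/3, n/2]\<close> and the \<open>d \<le> n / 36\<close> get a positive coefficient. The latter
  contribute at most \<open>\<psi>(n / 36)\<close>, which is less than the main term of the combination.
\<close>

section \<open>Chebyshev bound\<close>

text \<open>Write \<open>ln m\<close> as the sum of \<open>mangoldt d\<close> over
  \<open>d dvd m\<close> and swap the sums. Terms with \<open>d > N\<close> vanish as
  \<open>N div d = 0\<close>; the free bound \<open>M\<close> lets sums with different
  \<open>N\<close> share one range of \<open>d\<close>.\<close>

lemma weighted_ln_sum_eq_mangoldt:
  fixes w :: "nat \<Rightarrow> real"
  assumes "N \<le> M"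
  shows "(\<Sum>m=1..N. w m * ln m) = (\<Sum>d=1..M. mangoldt d * (\<Sum>e=1..N div d. w (d * e)))"
proof -
  have "(\<Sum>m=1..N. w m * ln m) = (\<Sum>m=1..N. \<Sum>d=1..M. if d dvd m then mangoldt d * w m else 0)"
  proof (rule sum.cong)
    fix m assume m: "m \<in> {1..N}"
    have "ln (real m) = (\<Sum>d | d dvd m. mangoldt d)"
      using m mangoldt_sum[of m, where ?'a = real] by simp
    also have "{d. d dvd m} = {d \<in> {1..M}. d dvd m}"
      using m assms by (auto dest: dvd_imp_le intro!: Nat.gr0I)
    finally show "w m * ln m = (\<Sum>d=1..M. if d dvd m then mangoldt d * w m else 0)"
      by (simp add: sum_distrib_left mult.commute flip: sum.inter_filter)
  qed simp
  also have "\<dots> = (\<Sum>d=1..M. \<Sum>m=1..N. if d dvd m then mangoldt d * w m else 0)"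
    by (rule sum.swap)
  also have "\<dots> = (\<Sum>d=1..M. mangoldt d * (\<Sum>e=1..N div d. w (d * e)))"
  proof (rule sum.cong)
    fix d assume d: "d \<in> {1..M}"
    have "(\<Sum>m=1..N. if d dvd m then mangoldt d * w m else 0) = (\<Sum>m | m \<in> {1..N} \<and> d dvd m. mangoldt d * w m)"
      by (simp flip: sum.inter_filter)
    also have "\<dots> = (\<Sum>e=1..N div d. mangoldt d * w (d * e))"
    proof (rule sum.reindex_bij_witness[of _ "\<lambda>e. d * e" "\<lambda>m. m div d"])
      fix m assume m: "m \<in> {m. m \<in> {1..N} \<and> d dvd m}"
      then show "d * (m div d) = m" by auto
      show "m div d \<in> {1..N div d}"
        using m d by (auto simp: div_le_mono Suc_le_eq div_greater_zero_iff dvd_imp_le)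
    next
      fix e assume e: "e \<in> {1..N div d}"
      show "d * e div d = e" using d by auto
      have "d * e \<le> N"
        using e d by (metis atLeastAtMost_iff le_trans mult_le_mono2 times_div_less_eq_dividend)
      with e d show "d * e \<in> {m. m \<in> {1..N} \<and> d dvd m}" by auto
    qed (use d in auto)
    finally show "(\<Sum>m=1..N. if d dvd m then mangoldt d * w m else 0) = mangoldt d * (\<Sum>e=1..N div d. w (d * e))"
      by (simp add: sum_distrib_left)
  qed simp
  finally show ?thesis .
qed

definition psi :: "nat \<Rightarrow> real" where
  "psi N = (\<Sum>d=1..N. mangoldt d)"

lemma ln_fact_eq_sum: "ln (fact N :: real) = (\<Sum>m=1..N. ln (real m))"
  by (induction N) (simp_all add: ln_mult del: of_nat_Suc)

lemma ln_fact_eq_mangoldt: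
  assumes "N \<le> M"
  shows "ln (fact N :: real) = (\<Sum>d=1..M. mangoldt d * real (N div d))"
  using weighted_ln_sum_eq_mangoldt[OF assms, of "\<lambda>_. 1"] by (simp add: ln_fact_eq_sum)

text \<open>The factorials form a central binomial coefficient, at most \<open>2 ^ (2 * M)\<close>,
  with an extra factor \<open>N\<close> when \<open>N\<close> is odd.\<close>

lemma ln_central_binomial_le:
  assumes "N > 0"
  shows "ln (fact N :: real) - 2 * ln (fact (N div 2)) \<le> N * ln 2 + ln N"
proof -
  define M where "M = N div 2"
  have even_case: "ln (fact (2 * M) :: real) - 2 * ln (fact M) \<le> 2 * M * ln 2"
  proof -
    have "(fact (2 * M) :: real) = fact M * fact M * real (2 * M choose M)"
      by (metis binomial_fact_lemma le_add2 mult_2 diff_add_inverse2 of_nat_fact of_nat_mult)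
    moreover have "(2 * M choose M) > 0" by simp
    ultimately have "ln (fact (2 * M) :: real) = 2 * ln (fact M) + ln (real (2 * M choose M))"
      by (simp add: ln_mult)
    moreover have "real (2 * M choose M) \<le> 2 ^ (2 * M)"
      by (metis binomial_le_pow2 numeral_power_le_of_nat_cancel_iff of_nat_le_iff of_nat_numeral of_nat_power)
    hence "ln (real (2 * M choose M)) \<le> ln (2 ^ (2 * M))"
      by (subst ln_le_cancel_iff) auto
    hence "ln (real (2 * M choose M)) \<le> 2 * M * ln 2"
      by (simp add: ln_realpow)
    ultimately show ?thesis by linarith
  qed
  show ?thesis
  proof (cases "even N")
    case True
    hence "N = 2 * M" by (simp add: M_def)
    moreover have "ln (real N) \<ge> 0" using assms by simp
    ultimately show ?thesis using even_case by simp
  next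
    case False
    hence N: "N = Suc (2 * M)" unfolding M_def by presburger
    have "ln (fact N :: real) = ln (real N) + ln (fact (2 * M))"
      unfolding N fact_Suc by (subst ln_mult) auto
    moreover have "2 * M * ln 2 \<le> N * ln (2::real)"
      unfolding N by (intro mult_right_mono) auto
    moreover note even_case
    ultimately have "ln (fact N :: real) - 2 * ln (fact M) \<le> N * ln 2 + ln N"
      by argo
    thus ?thesis by (simp only: M_def)
  qed
qed

text \<open>Chebyshev's argument: the weight \<open>N div d - 2 * (N div 2 div d)\<close> is
  nonnegative, and at least 1 for \<open>N div 2 < d\<close>, so the difference is bounded by the
  logarithm of the factorial quotient.\<close>

lemma psi_diff_le:
  assumes "N > 0"
  shows "psi N - psi (N div 2) \<le> N * ln 2 + ln N"
proof -
  have "psi N - psi (N div 2) = (\<Sum>d=1..N. mangoldt d * of_bool (d > N div 2))"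
  proof -
    have "psi N = (\<Sum>d=1..N. mangoldt d * of_bool (d > N div 2)) + (\<Sum>d=1..N. mangoldt d * of_bool (d \<le> N div 2))"
      unfolding psi_def sum.distrib[symmetric] by (intro sum.cong) auto
    moreover have "(\<Sum>d=1..N. mangoldt d * of_bool (d \<le> N div 2)) = psi (N div 2)"
      unfolding psi_def by (rule sum.mono_neutral_cong_right) auto
    ultimately show ?thesis by simp
  qed
  also have "\<dots> \<le> (\<Sum>d=1..N. mangoldt d * (real (N div d) - 2 * real (N div 2 div d)))"
  proof (intro sum_mono mult_left_mono mangoldt_nonneg)
    fix d assume d: "d \<in> {1..N}"
    have "real (2 * (N div 2 div d)) \<le> real (N div d)"
      unfolding of_nat_le_iff by (metis div_mult2_eq mult.commute times_div_less_eq_dividend)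
    moreover have "N div d \<ge> 1" using d by (simp add: Suc_le_eq div_greater_zero_iff)
    moreover have "N div 2 div d = 0" if "d > N div 2" using that by simp
    ultimately show "of_bool (d > N div 2) \<le> real (N div d) - 2 * real (N div 2 div d)"
      by (cases "d > N div 2") auto
  qed
  also have "\<dots> = ln (fact N) - 2 * ln (fact (N div 2))"
    using ln_fact_eq_mangoldt[of N N] ln_fact_eq_mangoldt[of "N div 2" N]
    by (simp add: sum_subtractf right_diff_distrib sum_distrib_left mult.left_commute)
  finally show ?thesis using ln_central_binomial_le[OF assms] by linarith
qed

lemma ln_2_ge_half: "ln (2::real) \<ge> 1 / 2"
proof -
  have "exp (1/2 :: real) ^ 2 \<le> 2 ^ 2"
    using exp_le by (simp flip: exp_double)
  hence "exp (1/2 :: real) \<le> 2" by (rule power2_le_imp_le) simp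
  thus ?thesis by (subst ln_ge_iff) auto
qed

text \<open>Repeated halving: the terms \<open>N * ln 2\<close> sum to at most
  \<open>2 * ln 2 * N\<close> as a geometric series, and the logarithmically many errors
  \<open>ln N\<close> produce the squared logarithm.\<close>

lemma psi_le:
  assumes "N > 0"
  shows "psi N \<le> 2 * ln 2 * N + ln N ^ 2 + ln N"
  using assms
proof (induction N rule: less_induct)
  case (less N)
  show ?case
  proof (cases "N = 1")
    case True
    thus ?thesis by (simp add: psi_def)
  next
    case False
    define x where "x = ln (real N) - ln 2"
    have M: "N div 2 > 0" "N div 2 < N" using False less.prems by auto
    have half: "real (N div 2) \<le> N / 2" by linarith
    hence "ln (real (N div 2)) \<le> ln (N / 2)"
      using M by (subst ln_le_cancel_iff) auto
    hence x: "ln (real (N div 2)) \<le> x"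
      using less.prems by (simp add: x_def ln_div)
    have ge0: "ln (real (N div 2)) \<ge> 0" using M by simp
    have "psi (N div 2) \<le> 2 * ln 2 * real (N div 2) + ln (real (N div 2)) ^ 2 + ln (real (N div 2))"
      using less.IH M by blast
    also have "\<dots> \<le> ln 2 * N + x ^ 2 + x"
      using x ge0 half by (intro add_mono power_mono) auto
    finally have "psi N \<le> 2 * ln 2 * N + x ^ 2 + x + ln N"
      using psi_diff_le[OF less.prems] by (simp add: mult.commute)
    \<comment> \<open>Since \<open>2 * ln 2 >= 1\<close>, the cross term of
      \<open>(x + ln 2) ^ 2\<close> absorbs the extra \<open>x\<close>.\<close>
    moreover have "x ^ 2 + x + ln N \<le> ln N ^ 2 + ln N"
    proof -
      have "x \<ge> 0" using x ge0 by linarith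
      hence "ln 2 * x \<ge> 1/2 * x" using ln_2_ge_half by (intro mult_right_mono) auto
      moreover have "ln (2::real) * ln 2 \<ge> 0" using ln_2_ge_half by (intro mult_nonneg_nonneg) auto
      moreover have "ln N = x + ln 2" by (simp add: x_def)
      moreover from this have "ln N ^ 2 = (x + ln 2) ^ 2" by simp
      moreover have "(x + ln 2) ^ 2 = x ^ 2 + 2 * (ln 2 * x) + ln 2 * ln 2"
        by (simp add: power2_eq_square algebra_simps)
      ultimately show ?thesis by linarith
    qed
    ultimately show ?thesis by linarith
  qed
qed

section \<open>Primes congruent to 1 modulo 3\<close>

definition ln_sum_mod3 :: "nat \<Rightarrow> nat \<Rightarrow> real" where
  "ln_sum_mod3 r N = (\<Sum>m=1..N. of_bool (m mod 3 = r) * ln (real m))"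

text \<open>Closed form, for \<open>r\<close> equal to 1 or 2, of the number of \<open>e\<close> in
  \<open>{1..N}\<close> congruent to \<open>r\<close> modulo 3.\<close>

definition count_mod3 :: "nat \<Rightarrow> nat \<Rightarrow> nat" where
  "count_mod3 r N = (N + (3 - r)) div 3"

lemma count_mod3_eq_sum:
  assumes "r \<in> {1, 2}"
  shows "(\<Sum>e=1..N. of_bool (e mod 3 = r)) = real (count_mod3 r N)"
proof (induction N)
  case 0
  show ?case using assms by (auto simp: count_mod3_def)
next
  case (Suc N)
  have "count_mod3 r (Suc N) = count_mod3 r N + of_bool (Suc N mod 3 = r)"
    using assms unfolding count_mod3_def by (auto simp: of_bool_def) presburger+
  thus ?case using Suc.IH by simp
qed

text \<open>If \<open>d mod 3 = 1\<close>, then \<open>d * e\<close> lies in the class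
  \<open>r\<close> iff \<open>e\<close> does; if \<open>d mod 3 = 2\<close>, iff \<open>e\<close>
  lies in the class of \<open>2 * r\<close>, which is \<open>3 - r\<close>. Multiples of 3
  contribute nothing.\<close>

lemma ln_sum_mod3_eq_mangoldt:
  assumes "N \<le> M" "r \<in> {1, 2}"
  shows "ln_sum_mod3 r N = (\<Sum>d=1..M. mangoldt d *
    (if d mod 3 = 1 then count_mod3 r (N div d) else if d mod 3 = 2 then count_mod3 (3 - r) (N div d) else 0))"
proof -
  have "(\<Sum>e=1..K. of_bool ((d * e) mod 3 = r)) =
    real (if d mod 3 = 1 then count_mod3 r K else if d mod 3 = 2 then count_mod3 (3 - r) K else 0)" for d K
  proof -
    have de: "(d * e) mod 3 = (d mod 3 * e) mod 3" for e by (simp add: mod_mult_left_eq)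
    consider "d mod 3 = 0" | "d mod 3 = 1" | "d mod 3 = 2" by linarith
    thus ?thesis
    proof cases
      case 1
      thus ?thesis using assms(2) by (auto simp: de simp del: mod_mult_left_eq)
    next
      case 2
      thus ?thesis using count_mod3_eq_sum[OF assms(2), of K]
        by (simp add: de del: mod_mult_left_eq)
    next
      case 3
      have "(2 * e) mod 3 = r \<longleftrightarrow> e mod 3 = 3 - r" for e
        using assms(2) by auto presburger+
      moreover have "3 - r \<in> {1, 2}" using assms(2) by auto
      ultimately show ?thesis using count_mod3_eq_sum[of "3 - r" K] 3
        by (simp add: de del: mod_mult_left_eq)
    qed
  qed
  thus ?thesis
    unfolding ln_sum_mod3_def weighted_ln_sum_eq_mangoldt[OF assms(1), of "\<lambda>m. of_bool (m mod 3 = r)"]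
    by simp
qed

text \<open>
  The coefficient of \<open>\<Lambda>(d)\<close>, \<open>d \<equiv> r (mod 3)\<close>, in \<open>cheb_sum n\<close> below, where \<open>Y = n div d\<close>. The combination
  was found by linear programming: its signs satisfy \<open>\<Sum> \<plusminus>1/k = 0\<close>, so that the terms of order
  \<open>n ln n\<close> cancel.
\<close>

definition cheb_weight :: "nat \<Rightarrow> nat \<Rightarrow> int" where
  "cheb_weight r Y = int (count_mod3 r (Y div 2)) - int (count_mod3 r (Y div 3))
     - int (count_mod3 (3 - r) (Y div 4)) + int (count_mod3 (3 - r) (Y div 6))
     - int (count_mod3 r (Y div 10)) - int (count_mod3 (3 - r) (Y div 10))
     + int (count_mod3 r (Y div 20)) + int (count_mod3 (3 - r) (Y div 20))
     + int (count_mod3 r (Y div 60))"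

definition cheb_sum :: "nat \<Rightarrow> real" where
  "cheb_sum n = ln_sum_mod3 1 (n div 2) - ln_sum_mod3 1 (n div 3)
     - ln_sum_mod3 2 (n div 4) + ln_sum_mod3 2 (n div 6)
     - ln_sum_mod3 1 (n div 10) - ln_sum_mod3 2 (n div 10)
     + ln_sum_mod3 1 (n div 20) + ln_sum_mod3 2 (n div 20)
     + ln_sum_mod3 1 (n div 60)"

text \<open>Every divisor \<open>k\<close> in use divides 60, so the shift adds
  \<open>60 * q / k\<close> to the count for \<open>k\<close>; these increments cancel because the
  signed sum of \<open>1 / k\<close> is 0.\<close>

lemma cheb_weight_periodic: "cheb_weight r (180 * q + s) = cheb_weight r s"
proof -
  have c: "count_mod3 i (3 * j + t) = j + count_mod3 i t" for i j t
    by (simp add: count_mod3_def)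
  have "(180 * q + s) div 2 = 3 * (30 * q) + s div 2" "(180 * q + s) div 3 = 3 * (20 * q) + s div 3"
    "(180 * q + s) div 4 = 3 * (15 * q) + s div 4" "(180 * q + s) div 6 = 3 * (10 * q) + s div 6"
    "(180 * q + s) div 10 = 3 * (6 * q) + s div 10" "(180 * q + s) div 20 = 3 * (3 * q) + s div 20"
    "(180 * q + s) div 60 = 3 * q + s div 60"
    by presburger+
  thus ?thesis by (simp only: cheb_weight_def c)
qed

text \<open>By periodicity it suffices to check one period. For \<open>Y >= 36\<close> only the
  bound 1 is kept; for \<open>Y < 36\<close> reduction modulo 180 changes nothing.\<close>

lemma cheb_weight_le:
  assumes "r \<in> {1, 2}"
  shows "cheb_weight r Y \<le> of_bool (r = 1 \<and> Y = 2) + of_bool (Y \<ge> 36)"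
proof -
  \<comment> \<open>0 and 1 are listed separately because \<open>upt_rec_numeral\<close> unfolds
    only intervals between numerals.\<close>
  have "list_all (\<lambda>s. cheb_weight 1 s \<le> (if s = 2 \<or> s \<ge> 36 then 1 else 0) \<and>
     cheb_weight 2 s \<le> (if s \<ge> 36 then 1 else 0)) (0 # 1 # [2..<180])"
    by (simp add: cheb_weight_def count_mod3_def)
  moreover have "s \<in> set (0 # 1 # [2..<180])" if "s < 180" for s :: nat
    using that by (auto simp del: upt_rec_numeral)
  ultimately have "\<forall>s<180. cheb_weight 1 s \<le> (if s = 2 \<or> s \<ge> 36 then 1 else 0) \<and>
     cheb_weight 2 s \<le> (if s \<ge> 36 then 1 else 0)" unfolding list_all_iff by blast
  hence *: "cheb_weight 1 (Y mod 180) \<le> (if Y mod 180 = 2 \<or> Y mod 180 \<ge> 36 then 1 else 0)"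
    "cheb_weight 2 (Y mod 180) \<le> (if Y mod 180 \<ge> 36 then 1 else 0)" by auto
  show ?thesis
  proof (cases "Y \<ge> 36")
    case True
    have "cheb_weight r (Y mod 180) \<le> 1" using * assms by (auto split: if_splits)
    moreover have "cheb_weight r Y = cheb_weight r (Y mod 180)"
      using cheb_weight_periodic[of r "Y div 180" "Y mod 180"] by simp
    ultimately show ?thesis using True by simp
  next
    case False
    thus ?thesis using * assms by (auto simp: of_bool_def split: if_splits)
  qed
qed

lemma cheb_sum_eq_mangoldt:
  "cheb_sum n = (\<Sum>d=1..n. mangoldt d *
    (if d mod 3 = 1 then cheb_weight 1 (n div d) else if d mod 3 = 2 then cheb_weight 2 (n div d) else 0))"
proof -
  \<comment> \<open>The contribution of \<open>d\<close> to \<open>ln_sum_mod3 r (n div k)\<close>.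
    Floor divisions by \<open>k\<close> and by \<open>d\<close> commute, so all nine sums see
    \<open>d\<close> only through its residue and \<open>n div d\<close>.\<close>
  define T where "T r k d = mangoldt d * real
    (if d mod 3 = 1 then count_mod3 r (n div d div k) else if d mod 3 = 2 then count_mod3 (3 - r) (n div d div k) else 0)"
    for r k d :: nat
  have swap: "n div k div d = n div d div k" for k d
    by (metis div_mult2_eq mult.commute)
  have E: "ln_sum_mod3 r (n div k) = (\<Sum>d=1..n. T r k d)" if "r = 1 \<or> r = 2" for r k
    using that ln_sum_mod3_eq_mangoldt[OF div_le_dividend, of r n k] unfolding T_def swap[of k] by simp
  have "mangoldt d * (if d mod 3 = 1 then cheb_weight 1 (n div d) else if d mod 3 = 2 then cheb_weight 2 (n div d) else 0)
    = T 1 2 d - T 1 3 d - T 2 4 d + T 2 6 d - T 1 10 d - T 2 10 d + T 1 20 d + T 2 20 d + T 1 60 d" for d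
    by (simp add: T_def cheb_weight_def algebra_simps)
  thus ?thesis
    by (simp add: cheb_sum_def E sum.distrib sum_subtractf)
qed

section \<open>Main terms of the logarithm sums\<close>

text \<open>An antiderivative of \<open>ln\<close>, used in place of the integral.\<close>

definition ln_prim :: "real \<Rightarrow> real" where
  "ln_prim u = u * ln u - u"

text \<open>The integral of the increasing function \<open>ln\<close> over \<open>[x, y]\<close>
  lies between its endpoint estimates; here this follows from \<open>ln_diff_le\<close>
  alone.\<close>

lemma ln_prim_diff_bounds:
  assumes "0 < x" "x \<le> y"
  shows "(y - x) * ln x \<le> ln_prim y - ln_prim x" "ln_prim y - ln_prim x \<le> (y - x) * ln y"
proof -
  have "ln x - ln y \<le> (x - y) / y" using assms by (intro ln_diff_le) auto
  hence "y * (ln x - ln y) \<le> x - y" using assms by (simp add: field_simps)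
  thus "(y - x) * ln x \<le> ln_prim y - ln_prim x"
    by (simp add: ln_prim_def algebra_simps)
  have "ln y - ln x \<le> (y - x) / x" using assms by (intro ln_diff_le) auto
  hence "x * (ln y - ln x) \<le> y - x" using assms by (simp add: field_simps)
  thus "ln_prim y - ln_prim x \<le> (y - x) * ln y"
    by (simp add: ln_prim_def algebra_simps)
qed

lemma ln_3_ge_1: "ln (3::real) \<ge> 1"
  using exp_le by (subst ln_ge_iff) auto

text \<open>Induction in steps of 3: each block of three integers contributes one logarithm
  \<open>t\<close>, and both \<open>3 * t\<close> and the increment of \<open>ln_prim\<close> lie
  between \<open>3 * ln K\<close> and \<open>3 * ln (K + 3)\<close>. The error thus grows by at most
  the difference of these, which telescopes. The constant 1 is the error at
  \<open>N = 1\<close>.\<close>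

lemma ln_sum_mod3_bounds:
  assumes "N > 0" "r \<in> {1, 2}"
  shows "\<bar>3 * ln_sum_mod3 r N - ln_prim N\<bar> \<le> 3 * ln N + 1"
  using assms(1)
proof (induction N rule: less_induct)
  case (less N)
  consider "N = 1" | "N = 2" | "N = 3" | K where "N = K + 3" "K > 0"
    using less.prems that(4)[of "N - 3"] by linarith
  thus ?case
  proof cases
    case 1
    thus ?thesis by (simp add: ln_sum_mod3_def ln_prim_def)
  next
    case 2
    have "ln_sum_mod3 r 2 = (if r = 2 then ln 2 else 0)"
      using assms(2) by (auto simp: ln_sum_mod3_def numeral_2_eq_2)
    moreover have "ln (2::real) \<le> 1" using ln_le_minus_one[of 2] by simp
    ultimately show ?thesis using 2 ln_2_ge_half by (auto simp: ln_prim_def abs_le_iff)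
  next
    case 3
    have "{1..3} = {1, 2, 3 :: nat}" by auto
    hence "ln_sum_mod3 r 3 = (if r = 2 then ln 2 else 0)"
      using assms(2) by (auto simp: ln_sum_mod3_def)
    moreover have "ln (2::real) \<le> 1" using ln_le_minus_one[of 2] by simp
    ultimately show ?thesis using 3 ln_3_ge_1 ln_2_ge_half by (auto simp: ln_prim_def abs_le_iff)
  next
    case 4
    have "{1..K + 3} = {1..K} \<union> {K + 1, K + 2, K + 3}" by auto
    hence "ln_sum_mod3 r (K + 3) = ln_sum_mod3 r K +
      (\<Sum>m\<in>{K + 1, K + 2, K + 3}. of_bool (m mod 3 = r) * ln (real m))"
      unfolding ln_sum_mod3_def by (subst sum.union_disjoint[symmetric]) auto
    moreover have "(\<Sum>m\<in>{K + 1, K + 2, K + 3}. of_bool (m mod 3 = r) * ln (real m)) \<in> {ln (K + 1), ln (K + 2), ln (K + 3)}"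
    proof -
      have "r = 1 \<or> r = 2" using assms(2) by auto
      hence "(K + 1) mod 3 = r \<and> (K + 2) mod 3 \<noteq> r \<and> (K + 3) mod 3 \<noteq> r
        \<or> (K + 1) mod 3 \<noteq> r \<and> (K + 2) mod 3 = r \<and> (K + 3) mod 3 \<noteq> r
        \<or> (K + 1) mod 3 \<noteq> r \<and> (K + 2) mod 3 \<noteq> r \<and> (K + 3) mod 3 = r"
        by presburger
      thus ?thesis by (elim disjE) (simp_all add: add.commute)
    qed
    ultimately obtain t where t: "ln_sum_mod3 r (K + 3) = ln_sum_mod3 r K + t"
      and tin: "t \<in> {ln (K + 1), ln (K + 2), ln (K + 3)}" by blast
    have t_bounds: "ln K \<le> t" "t \<le> ln (K + 3)"
      using tin 4 by auto
    have "\<bar>3 * ln_sum_mod3 r K - ln_prim K\<bar> \<le> 3 * ln K + 1"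
      using less.IH[of K] 4 by simp
    moreover have "3 * ln K \<le> ln_prim (K + 3) - ln_prim K" "ln_prim (K + 3) - ln_prim K \<le> 3 * ln (K + 3)"
      using ln_prim_diff_bounds[of K "K + 3"] 4 by simp_all
    ultimately show ?thesis using t t_bounds 4(1) by (simp add: abs_le_iff)
  qed
qed

text \<open>Passing from \<open>n div k\<close> to \<open>n / k\<close> moves the argument of
  \<open>ln_prim\<close> by at most 1, at the cost of one further \<open>ln n\<close>.\<close>

lemma ln_sum_mod3_div_bounds:
  assumes "k > 0" "k \<le> n" "r \<in> {1, 2}"
  shows "\<bar>3 * ln_sum_mod3 r (n div k) - ln_prim (n / k)\<bar> \<le> 4 * ln n + 1"
proof -
  define N where "N = n div k"
  have N: "N > 0" "N \<le> n" using assms by (auto simp: N_def div_greater_zero_iff)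
  have le: "real N \<le> n / k" unfolding N_def by (rule of_nat_div_le_of_nat)
  have "real n \<le> real (k * (N + 1))"
    unfolding N_def of_nat_le_iff using dividend_less_times_div[of k n] assms(1) by simp
  hence lt: "n / k - N \<le> 1" using assms(1) by (simp add: field_simps)
  have "ln N \<le> ln n" using N by simp
  have "(n / k - N) * ln N \<ge> 0" using le N by simp
  moreover have "ln (n / k) \<le> ln n"
    using assms by (subst ln_le_cancel_iff) (auto simp: field_simps)
  hence "(n / k - N) * ln (n / k) \<le> 1 * ln n"
    using le lt N by (intro mult_mono) auto
  moreover have "(n / k - N) * ln N \<le> ln_prim (n / k) - ln_prim N"
    "ln_prim (n / k) - ln_prim N \<le> (n / k - N) * ln (n / k)"
    using ln_prim_diff_bounds[of N "n / k"] N le by simp_all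
  ultimately have "ln_prim (n / k) - ln_prim N \<in> {0..ln n}"
    unfolding atLeastAtMost_iff by linarith
  thus ?thesis using ln_sum_mod3_bounds[OF N(1) assms(3)] \<open>ln N \<le> ln n\<close>
    unfolding N_def by (auto simp: abs_le_iff)
qed

text \<open>Divided by 180, this says that the coefficient of \<open>n\<close> in
  \<open>cheb_sum_ge\<close> exceeds \<open>ln 2 / 18\<close>, the coefficient coming from
  \<open>psi (n div 36)\<close>, by at least 1/75.\<close>

lemma cheb_constant: "22 * ln 2 + 12 / 5 \<le> 9 * ln 3 + 5 * ln (5::real)"
proof -
  \<comment> \<open>The comparison goes through 14, since \<open>3 ^ 12 = 531441\<close> is just
    below \<open>14 ^ 5 = 537824\<close>.\<close>
  have "exp (12 / 5 :: real) ^ 5 = exp 1 ^ 12"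
    by (simp flip: exp_of_nat_mult)
  also have "\<dots> \<le> (3 :: real) ^ 12"
    using exp_le by (intro power_mono) auto
  also have "\<dots> \<le> (14 :: real) ^ 5" by simp
  finally have "exp (12 / 5 :: real) \<le> 14" by (rule power_le_imp_le_base[of _ 4, simplified]) simp
  hence "12 / 5 \<le> ln (14 :: real)" by (subst ln_ge_iff) auto
  moreover have "ln (2 ^ 22 * 14 :: real) \<le> ln (3 ^ 9 * 5 ^ 5)"
    by (subst ln_le_cancel_iff) auto
  hence "22 * ln 2 + ln 14 \<le> 9 * ln 3 + 5 * ln (5::real)"
    by (simp only: ln_mult ln_realpow) simp
  ultimately show ?thesis by linarith
qed

text \<open>As the signed sum of \<open>1 / k\<close> is 0, only the parts
  \<open>n / k * ln k\<close> of the main terms survive. Each of the nine sums has error at most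
  \<open>4 * L + 1\<close>, and \<open>n >= 60\<close> makes every \<open>n div k\<close>
  positive.\<close>

lemma cheb_sum_ge:
  assumes "n \<ge> 60"
  shows "cheb_sum n \<ge> (3 * ln 3 / 20 + ln 5 / 12 - ln 2 / 5) / 3 * n - 12 * ln n - 3"
proof -
  define L where "L = ln (real n)"
  have B: "\<bar>3 * ln_sum_mod3 r (n div k) - ln_prim (n / k)\<bar> \<le> 4 * L + 1"
    if "k \<in> {2, 3, 4, 6, 10, 20, 60}" "r = 1 \<or> r = 2" for k r
    unfolding L_def using that assms by (intro ln_sum_mod3_div_bounds) auto
  have P: "ln_prim (n / k) = n / k * L - n / k * ln k - n / k" if "k > 0" for k :: real
    using that assms by (simp add: ln_prim_def ln_div L_def right_diff_distrib)
  have l: "ln (4::real) = 2 * ln 2" "ln (6::real) = ln 2 + ln 3" "ln (10::real) = ln 2 + ln 5"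
    "ln (20::real) = 2 * ln 2 + ln 5" "ln (60::real) = 2 * ln 2 + ln 3 + ln 5"
    using ln_mult[of 2 "2::real"] ln_mult[of 2 "3::real"] ln_mult[of 2 "5::real"]
      ln_mult[of 4 "5::real"] ln_mult[of 3 "20::real"] by simp_all
  have "3 * cheb_sum n \<ge> ln_prim (n / 2) - ln_prim (n / 3) - ln_prim (n / 4) + ln_prim (n / 6)
      - 2 * ln_prim (n / 10) + 2 * ln_prim (n / 20) + ln_prim (n / 60) - 9 * (4 * L + 1)"
    using B[of 2 1] B[of 3 1] B[of 4 2] B[of 6 2] B[of 10 1] B[of 10 2] B[of 20 1] B[of 20 2] B[of 60 1]
    by (simp add: cheb_sum_def abs_le_iff)
  also have "ln_prim (n / 2) - ln_prim (n / 3) - ln_prim (n / 4) + ln_prim (n / 6)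
      - 2 * ln_prim (n / 10) + 2 * ln_prim (n / 20) + ln_prim (n / 60) =
      (3 * ln 3 / 20 + ln 5 / 12 - ln 2 / 5) * n"
    using P[of 2] P[of 3] P[of 4] P[of 6] P[of 10] P[of 20] P[of 60]
    by (simp add: l field_simps)
  finally show ?thesis by (simp add: L_def field_simps)
qed

section \<open>Upper bound for the combination\<close>

text \<open>Each prime has at most one power in the range, because successive powers differ by a
  factor of at least 2 and the endpoints only by 3/2. A proper power has its prime at most
  \<open>sqrt n\<close>, so there are at most \<open>sqrt n\<close> nonzero terms, each at most
  \<open>ln n / 2\<close>.\<close>

lemma sum_mangoldt_proper_prime_powers_le:
  fixes n :: nat
  shows "(\<Sum>d | d \<in> {1..n} \<and> 2 * d \<le> n \<and> n < 3 * d \<and> \<not> prime d. mangoldt d) \<le> sqrt n * (ln n / 2)"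
proof (cases "n = 0")
  case False
  define B where "B = {d \<in> {1..n}. 2 * d \<le> n \<and> n < 3 * d \<and> \<not> prime d \<and> primepow d}"
  have fin: "finite B" by (auto simp: B_def)
  have B: "\<exists>p k. prime p \<and> 2 \<le> k \<and> d = p ^ k \<and> aprimedivisor d = p \<and> real p \<le> sqrt n"
    if d: "d \<in> B" for d
  proof -
    obtain p k where pk: "prime p" "k > 0" "d = p ^ k"
      using d by (auto simp: B_def primepow_def)
    have "k \<noteq> 1" using d pk by (auto simp: B_def)
    hence "k \<ge> 2" using pk by simp
    have "p ^ 2 \<le> p ^ k"
      using pk \<open>k \<ge> 2\<close> by (intro power_increasing) (auto simp: prime_gt_0_nat Suc_le_eq)
    hence "p ^ 2 \<le> n" using d pk by (auto simp: B_def)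
    hence "real p \<le> sqrt n" by (intro real_le_rsqrt) (simp flip: of_nat_power)
    thus ?thesis using pk \<open>k \<ge> 2\<close> by (auto simp: aprimedivisor_prime_power)
  qed
  have "inj_on aprimedivisor B"
  proof (rule inj_onI)
    have le: "d' \<le> d" if dB: "d \<in> B" "d' \<in> B" "aprimedivisor d = aprimedivisor d'" for d d'
    proof (rule ccontr)
      assume "\<not> d' \<le> d"
      obtain p k where p: "prime p" "d = p ^ k" "aprimedivisor d = p" using B[OF dB(1)] by blast
      obtain l where l: "d' = p ^ l" using B[OF dB(2)] dB(3) p(3) by auto
      have "k < l"
      proof (rule ccontr)
        assume "\<not> k < l"
        hence "p ^ l \<le> p ^ k" using p by (intro power_increasing) (auto simp: prime_gt_0_nat Suc_le_eq)
        thus False using \<open>\<not> d' \<le> d\<close> p l by simp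
      qed
      hence "p ^ Suc k \<le> p ^ l" using p by (intro power_increasing) (auto simp: prime_gt_0_nat Suc_le_eq)
      moreover have "2 * p ^ k \<le> p ^ Suc k" using prime_ge_2_nat[OF p(1)] by simp
      ultimately have "2 * d \<le> d'" using p l by linarith
      thus False using dB by (auto simp: B_def)
    qed
    fix d d' assume "d \<in> B" "d' \<in> B" "aprimedivisor d = aprimedivisor d'"
    thus "d = d'" using le[of d d'] le[of d' d] by simp
  qed
  hence "card B \<le> card {1..nat \<lfloor>sqrt n\<rfloor>}"
  proof (rule card_inj_on_le)
    show "aprimedivisor ` B \<subseteq> {1..nat \<lfloor>sqrt n\<rfloor>}"
    proof
      fix p assume "p \<in> aprimedivisor ` B"
      then obtain d where "d \<in> B" "p = aprimedivisor d" by blast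
      with B[of d] have "prime p" "real p \<le> sqrt n" by auto
      thus "p \<in> {1..nat \<lfloor>sqrt n\<rfloor>}"
        using prime_gt_0_nat[of p] by (simp add: le_nat_floor Suc_le_eq)
    qed
  qed simp
  hence "card B \<le> nat \<lfloor>sqrt n\<rfloor>" by simp
  hence "real (card B) \<le> real (nat \<lfloor>sqrt n\<rfloor>)" by (simp only: of_nat_le_iff)
  also have "\<dots> \<le> sqrt n" by simp
  finally have card: "real (card B) \<le> sqrt n" .
  have "(\<Sum>d | d \<in> {1..n} \<and> 2 * d \<le> n \<and> n < 3 * d \<and> \<not> prime d. mangoldt d :: real) = (\<Sum>d\<in>B. mangoldt d)"
    by (rule sum.mono_neutral_right) (auto simp: B_def mangoldt_def)
  also have "\<dots> \<le> (\<Sum>d\<in>B. ln n / 2)"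
  proof (rule sum_mono)
    fix d assume "d \<in> B"
    then obtain p k where p: "prime p" "2 \<le> k" "d = p ^ k" "real p \<le> sqrt n" using B by blast
    have "mangoldt d = ln (real p)" using p by simp
    also have "\<dots> \<le> ln (sqrt n)"
      using p prime_gt_0_nat[OF p(1)] False by (subst ln_le_cancel_iff) auto
    finally show "mangoldt d \<le> ln n / 2" using False by (simp add: ln_sqrt)
  qed
  also have "\<dots> = real (card B) * (ln n / 2)" by simp
  also have "\<dots> \<le> sqrt n * (ln n / 2)"
    using card False by (intro mult_right_mono) auto
  finally show ?thesis .
qed simp

lemma cheb_sum_le:
  fixes n :: nat
  assumes "n > 0" and no_prime: "\<And>p. prime p \<Longrightarrow> p mod 3 = 1 \<Longrightarrow> 2 * p \<le> n \<Longrightarrow> \<not> n < 3 * p"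
  shows "cheb_sum n \<le> sqrt n * (ln n / 2) + psi (n div 36)"
proof -
  have "cheb_sum n \<le> (\<Sum>d=1..n. (if 2 * d \<le> n \<and> n < 3 * d \<and> \<not> prime d then mangoldt d else 0)
      + (if d \<le> n div 36 then mangoldt d else 0))"
    unfolding cheb_sum_eq_mangoldt
  proof (rule sum_mono)
    fix d assume d: "d \<in> {1..n}"
    define w where "w = (if d mod 3 = 1 then cheb_weight 1 (n div d) else if d mod 3 = 2 then cheb_weight 2 (n div d) else 0)"
    define v :: int where "v = of_bool (d mod 3 = 1 \<and> n div d = 2) + of_bool (n div d \<ge> 36)"
    have "w \<le> v"
      using cheb_weight_le[of 1 "n div d"] cheb_weight_le[of 2 "n div d"]
      by (auto simp: w_def v_def)
    have "n div d = 2 \<longleftrightarrow> 2 \<le> n div d \<and> n div d < 3" by linarith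
    hence "n div d = 2 \<longleftrightarrow> 2 * d \<le> n \<and> n < 3 * d"
      using d by (simp add: less_eq_div_iff_mult_less_eq div_less_iff_less_mult)
    moreover have "36 \<le> n div d \<longleftrightarrow> d \<le> n div 36"
      using d by (simp add: less_eq_div_iff_mult_less_eq mult.commute)
    ultimately have v: "v = of_bool (d mod 3 = 1 \<and> 2 * d \<le> n \<and> n < 3 * d) + of_bool (d \<le> n div 36)"
      by (simp add: v_def)
    have "mangoldt d * w \<le> mangoldt d * real_of_int v"
      using \<open>w \<le> v\<close> by (intro mult_left_mono mangoldt_nonneg) simp
    \<comment> \<open>By \<open>no_prime\<close>, a \<open>d\<close> counted by the first indicator
      is not prime; its residue condition is then dropped.\<close>
    also have "\<dots> \<le> (if 2 * d \<le> n \<and> n < 3 * d \<and> \<not> prime d then mangoldt d else 0)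
      + (if d \<le> n div 36 then mangoldt d else 0)"
      using no_prime[of d] mangoldt_nonneg[of d] unfolding v by auto
    finally show "mangoldt d * (if d mod 3 = 1 then cheb_weight 1 (n div d) else if d mod 3 = 2 then cheb_weight 2 (n div d) else 0)
      \<le> (if 2 * d \<le> n \<and> n < 3 * d \<and> \<not> prime d then mangoldt d else 0)
      + (if d \<le> n div 36 then mangoldt d else 0)"
      unfolding w_def .
  qed
  also have "\<dots> = (\<Sum>d | d \<in> {1..n} \<and> 2 * d \<le> n \<and> n < 3 * d \<and> \<not> prime d. mangoldt d) + psi (n div 36)"
  proof -
    have "(\<Sum>d=1..n. if d \<le> n div 36 then mangoldt d else 0) = psi (n div 36)"
      unfolding psi_def by (rule sum.mono_neutral_cong_right) auto
    thus ?thesis by (simp add: sum.distrib flip: sum.inter_filter)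
  qed
  also have "\<dots> \<le> sqrt n * (ln n / 2) + psi (n div 36)"
    using sum_mangoldt_proper_prime_powers_le[of n] by simp
  finally show ?thesis .
qed

section \<open>Existence of the prime for large \<open>n\<close>\<close>

lemma ln_1000_le: "ln (1000::real) \<le> 10"
proof -
  have "ln (1000::real) \<le> ln (2 ^ 10)" by (subst ln_le_cancel_iff) auto
  also have "\<dots> = 10 * ln 2" by (subst ln_realpow) auto
  finally show ?thesis using ln_le_minus_one[of "2 :: real"] by simp
qed

text \<open>To be used with \<open>s = sqrt n\<close>. The tangent of \<open>ln\<close> at 1000
  gives \<open>ln s <= 10 + y\<close> where \<open>s = 1000 * (1 + y)\<close>, leaving two
  quadratics in \<open>y >= 0\<close> whose difference has positive coefficients.\<close>

lemma error_terms_less: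
  fixes s :: real
  assumes "s \<ge> 1000"
  shows "s * ln s + ((2 * ln s)\<^sup>2 + 2 * ln s) + 24 * ln s + 3 < s\<^sup>2 / 75"
proof -
  define y where "y = s / 1000 - 1"
  have y: "y \<ge> 0" "s = 1000 * (1 + y)" using assms by (auto simp: y_def)
  have "ln s - ln 1000 \<le> (s - 1000) / 1000" using assms by (intro ln_diff_le) auto
  hence ln: "ln s \<le> 10 + y" using ln_1000_le by (simp add: y_def diff_divide_distrib)
  have "ln s \<ge> 0" using assms by simp
  have "s * ln s \<le> s * (10 + y)" using ln assms by (intro mult_left_mono) auto
  moreover have "(2 * ln s)\<^sup>2 \<le> (2 * (10 + y))\<^sup>2"
    using ln \<open>ln s \<ge> 0\<close> by (intro power_mono) auto
  moreover have "y * y \<ge> 0" by simp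
  hence "s * (10 + y) + ((2 * (10 + y))\<^sup>2 + 2 * (10 + y)) + 24 * (10 + y) + 3 < s\<^sup>2 / 75"
    using y(1) unfolding y(2) power2_eq_square
    by (auto simp: algebra_simps intro!: add_pos_nonneg)
  moreover have "s * ln s + ((2 * ln s)\<^sup>2 + 2 * ln s) + 24 * ln s + 3
      \<le> s * (10 + y) + ((2 * (10 + y))\<^sup>2 + 2 * (10 + y)) + 24 * (10 + y) + 3"
    using calculation(1,2) ln by (intro add_mono) auto
  ultimately show ?thesis by linarith
qed

text \<open>Otherwise the two bounds for \<open>cheb_sum n\<close> would force \<open>n / 75\<close>
  below an error of order \<open>sqrt n * ln n\<close>.\<close>

lemma exists_prime_1_mod_3_large:
  fixes n :: nat
  assumes "n \<ge> 1000000"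
  shows "\<exists>p. prime p \<and> p mod 3 = 1 \<and> 2 * p \<le> n \<and> n < 3 * p"
proof (rule ccontr)
  assume no: "\<not> ?thesis"
  define s where "s = sqrt n"
  have s: "s \<ge> 1000" unfolding s_def using assms by (intro real_le_rsqrt) simp
  have n: "real n = s\<^sup>2" by (simp add: s_def)
  have L: "ln n = 2 * ln s" using s unfolding n by (simp add: ln_realpow)
  define N where "N = n div 36"
  have N: "N > 0" "N \<le> n" using assms by (auto simp: N_def div_greater_zero_iff)
  have lnN: "0 \<le> ln N" "ln N \<le> ln n" using N by auto
  have "psi N \<le> 2 * ln 2 * N + ln N ^ 2 + ln N" using psi_le N by blast
  also have "\<dots> \<le> 2 * ln 2 * (n / 36) + ln n ^ 2 + ln n"
    using lnN of_nat_div_le_of_nat[of n 36, where ?'a = real] by (intro add_mono mult_left_mono power_mono) (auto simp: N_def)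
  finally have "psi N \<le> ln 2 / 18 * n + ln n ^ 2 + ln n" by (simp add: mult.commute)
  moreover have "cheb_sum n \<le> sqrt n * (ln n / 2) + psi N"
    unfolding N_def using assms no by (intro cheb_sum_le) auto
  moreover have "cheb_sum n \<ge> (3 * ln 3 / 20 + ln 5 / 12 - ln 2 / 5) / 3 * n - 12 * ln n - 3"
    using assms by (intro cheb_sum_ge) auto
  moreover have "(3 * ln 3 / 20 + ln 5 / 12 - ln 2 / 5) / 3 * n - ln 2 / 18 * n \<ge> n / 75"
  proof -
    have "(3 * ln 3 / 20 + ln 5 / 12 - ln 2 / 5) / 3 - ln 2 / 18 \<ge> (1 / 75 :: real)"
      using cheb_constant by (simp add: field_simps)
    hence "((3 * ln 3 / 20 + ln 5 / 12 - ln 2 / 5) / 3 - ln 2 / 18) * n \<ge> 1 / 75 * real n"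
      by (intro mult_right_mono) auto
    thus ?thesis by (simp add: left_diff_distrib)
  qed
  ultimately have "n / 75 \<le> sqrt n * (ln n / 2) + ln n ^ 2 + ln n + 12 * ln n + 3" by linarith
  hence "s\<^sup>2 / 75 \<le> s * ln s + ((2 * ln s)\<^sup>2 + 2 * ln s) + 24 * ln s + 3"
    unfolding L n[symmetric] by (simp add: s_def)
  thus False using error_terms_less[OF s] by linarith
qed

section \<open>Existence of the prime for small \<open>n\<close>\<close>

text \<open>The intervals \<open>[2 * p, 3 * p)\<close> leave no gap: if \<open>3 * p <= n\<close>,
  the next entry \<open>q\<close> has \<open>2 * q <= n\<close>.\<close>

lemma successively_cover:
  fixes ps :: "nat list"
  assumes "successively (\<lambda>p q. 2 * q \<le> 3 * p) ps" "ps \<noteq> []" "2 * hd ps \<le> n" "n < 3 * last ps"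
  shows "\<exists>p\<in>set ps. 2 * p \<le> n \<and> n < 3 * p"
  using assms
proof (induction ps rule: induct_list012)
  case (3 p q ps)
  thus ?case by (cases "n < 3 * p") auto
qed auto

text \<open>Both ends of the search range are explicit, so that evaluation can raise the lower end
  one by one.\<close>

definition no_divisor_in :: "nat \<Rightarrow> nat \<Rightarrow> nat \<Rightarrow> bool" where
  "no_divisor_in p a b \<longleftrightarrow> (\<forall>d. a \<le> d \<and> d < b \<longrightarrow> \<not> d dvd p)"

lemma no_divisor_in_step:
  "no_divisor_in p a b \<longleftrightarrow> (if a < b then \<not> a dvd p \<and> no_divisor_in p (a + 1) b else True)"
proof (cases "a < b")
  case True
  have "a \<le> d \<longleftrightarrow> d = a \<or> a + 1 \<le> d" for d by linarith
  thus ?thesis using True unfolding no_divisor_in_def by auto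
qed (auto simp: no_divisor_in_def)

text \<open>As a rewrite rule: the conditional keeps the recursive call from being unfolded before the bound is tested.\<close>

lemma no_divisor_in_numeral:
  "no_divisor_in p (numeral a) (numeral b) \<longleftrightarrow>
    (if (numeral a :: nat) < numeral b
     then \<not> numeral a dvd p \<and> no_divisor_in p (numeral (Num.inc a)) (numeral b) else True)"
  unfolding numeral_inc by (rule no_divisor_in_step)

lemma prime_nat_trial_division:
  fixes p k :: nat
  assumes "1 < p" "p < k * k" "no_divisor_in p 2 k"
  shows "prime p"
  unfolding prime_nat_iff
proof (intro conjI allI impI)
  fix d assume "d dvd p"
  then obtain e where e: "p = d * e" ..
  show "d = 1 \<or> d = p"
  proof (rule ccontr)
    assume "\<not> (d = 1 \<or> d = p)"
    hence "d \<noteq> 1" "e \<noteq> 1" using e by auto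
    moreover have "d \<noteq> 0" "e \<noteq> 0" using e assms(1) by (auto intro: Nat.gr0I)
    ultimately have "2 \<le> d" "2 \<le> e" by linarith+
    hence "k \<le> d" "k \<le> e"
      using assms(3) e unfolding no_divisor_in_def by (metis dvd_triv_left dvd_triv_right not_less)+
    hence "k * k \<le> p" unfolding e by (rule mult_le_mono)
    thus False using assms(2) by simp
  qed
qed (rule assms(1))

lemma exists_prime_1_mod_3:
  fixes n :: nat
  assumes "n \<ge> 62"
  shows "\<exists>p. prime p \<and> p mod 3 = 1 \<and> 2 * p \<le> n \<and> n < 3 * p"
proof (cases "n \<ge> 1000000")
  case True
  thus ?thesis by (rule exists_prime_1_mod_3_large)
next
  case False
  \<comment> \<open>Each prime, congruent to 1 modulo 3, comes with a bound \<open>k\<close> for its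
    trial division, and is at most 3/2 times its predecessor. The ends fit since
    \<open>2 * 31 = 62\<close> and \<open>3 * 490783 > 1000000\<close>.\<close>
  define pks :: "(nat \<times> nat) list" where "pks = [(31, 6), (43, 7), (61, 8), (79, 9), (109, 11), (163, 13), (241, 16), (349, 19), (523, 23),
    (769, 28), (1153, 34), (1723, 42), (2557, 51), (3823, 62), (5701, 76), (8539, 93),
    (12799, 114), (19183, 139), (28771, 170), (43117, 208), (64663, 255), (96979, 312),
    (145459, 382), (218149, 468), (327211, 573), (490783, 701)]"
  have "\<exists>p\<in>set (map fst pks). 2 * p \<le> n \<and> n < 3 * p"
    using False assms by (intro successively_cover) (auto simp: pks_def)
  then obtain p k where pk: "(p, k) \<in> set pks" "2 * p \<le> n" "n < 3 * p" by auto
  have "\<forall>(p, k)\<in>set pks. p mod 3 = 1 \<and> 1 < p \<and> p < k * k \<and> no_divisor_in p 2 k"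
    by (simp add: pks_def no_divisor_in_numeral)
  with pk(1) have "p mod 3 = 1" "prime p" by (auto intro!: prime_nat_trial_division[of p k])
  thus ?thesis using pk by blast
qed

section \<open>Totients of factorials\<close>

text \<open>The only multiples of \<open>p\<close> up to \<open>n\<close> are \<open>p\<close> and
  \<open>2 * p\<close>, and each has one factor \<open>p\<close> because \<open>p\<close> is
  odd.\<close>

lemma multiplicity_fact_eq_2:
  fixes p n :: nat
  assumes "prime p" "p \<noteq> 2" "2 * p \<le> n" "n < 3 * p"
  shows "multiplicity p (fact n :: nat) = 2"
proof -
  have "p > 2" using assms prime_ge_2_nat[of p] by linarith
  hence "\<not> p dvd 2" by (auto dest: dvd_imp_le)
  have "multiplicity p (fact n :: nat) = (\<Sum>i\<in>{1..n}. multiplicity p i)"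
    unfolding fact_prod using assms by (subst of_nat_id, subst prime_elem_multiplicity_prod_distrib) auto
  also have "\<dots> = (\<Sum>i\<in>{p, 2 * p}. multiplicity p i)"
  proof (rule sum.mono_neutral_right)
    show "\<forall>i\<in>{1..n} - {p, 2 * p}. multiplicity p i = 0"
    proof
      fix i assume i: "i \<in> {1..n} - {p, 2 * p}"
      have "\<not> p dvd i"
      proof
        assume "p dvd i"
        then obtain k where k: "i = p * k" ..
        have "i < 3 * p" using i assms(4) by simp
        hence "p * k < p * 3" unfolding k by (simp only: mult.commute)
        hence "k < 3" by simp
        hence "k = 0 \<or> k = 1 \<or> k = 2" by linarith
        thus False using i k by (elim disjE) auto
      qed
      thus "multiplicity p i = 0" by (rule not_dvd_imp_multiplicity_0)
    qed
  qed (use assms \<open>p > 2\<close> in auto)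
  also have "\<dots> = multiplicity p p + multiplicity p (p * 2)"
    using \<open>p > 2\<close> by (simp add: mult.commute)
  also have "\<dots> = 2"
    using assms \<open>p > 2\<close> \<open>\<not> p dvd 2\<close>
    by (simp add: multiplicity_times_same not_dvd_imp_multiplicity_0 multiplicity_self)
  finally show ?thesis .
qed

text \<open>In the product formula, \<open>p\<close> cannot divide a factor
  \<open>q ^ (multiplicity q n - 1)\<close>, since then \<open>p = q\<close> would divide
  \<open>n\<close>.\<close>

lemma prime_dvd_totientD:
  assumes "prime p" "p dvd totient n" "n > 0" "\<not> p dvd n"
  shows "\<exists>q. prime q \<and> q dvd n \<and> p dvd q - 1"
proof -
  have "p dvd (\<Prod>q\<in>prime_factors n. q ^ (multiplicity q n - 1) * (q - 1))"
    using assms by (simp add: totient_formula1)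
  then obtain q where q: "q \<in> prime_factors n" "p dvd q ^ (multiplicity q n - 1) * (q - 1)"
    using assms(1) by (auto simp: prime_dvd_prod_iff)
  have "\<not> p dvd q ^ (multiplicity q n - 1)"
    using assms q(1) prime_dvd_power primes_dvd_imp_eq[of p q] by (metis in_prime_factors_iff)
  hence "p dvd q - 1" using q(2) assms(1) by (simp add: prime_dvd_mult_iff)
  thus ?thesis using q(1) by (auto simp: in_prime_factors_iff)
qed

text \<open>The part \<open>p ^ 2\<close> of the quotient has totient \<open>p * (p - 1)\<close>. A
  further factor \<open>p\<close> needs a prime \<open>q <= n < 3 * p\<close> of the form
  \<open>p * k + 1\<close>, but \<open>p + 1\<close> is even and \<open>2 * p + 1\<close> is
  excluded. On the other side \<open>p\<close> divides \<open>x\<close>, hence \<open>p ^ 2\<close>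
  divides \<open>x ^ m\<close>.\<close>

lemma totient_fact_quotient_not_power:
  fixes a b c m n p x :: nat
  assumes p: "prime p" "p \<noteq> 2" "2 * p \<le> n" "n < 3 * p" "\<not> (prime (2 * p + 1) \<and> 2 * p + 1 \<le> n)"
    and abc: "0 < a" "a < p" "0 < b" "b < p" "0 < c" "c < p"
    and m: "m \<ge> 2" and dvd: "b dvd a * fact n"
  shows "totient (a * fact n div b) \<noteq> c * x ^ m"
proof
  assume eq: "totient (a * fact n div b) = c * x ^ m"
  have not_dvd: "\<not> p dvd k" if "0 < k" "k < p" for k
    using that by (auto dest: dvd_imp_le)
  define N where "N = a * fact n div b"
  have N: "N * b = a * fact n" using dvd by (simp add: N_def)
  hence "N > 0" using abc by (metis fact_gt_zero gr0I mult_is_0 neq0_conv)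
  have "multiplicity p N = multiplicity p (N * b)"
    using p(1) not_dvd[OF abc(3,4)]
    by (simp add: multiplicity_prime_elem_times_other mult.commute[of N])
  also have "\<dots> = 2"
    using p(1) not_dvd[OF abc(1,2)] multiplicity_fact_eq_2[OF p(1-4)]
    by (simp add: N multiplicity_prime_elem_times_other)
  finally have "multiplicity p N = 2" .
  moreover obtain M where "N = p ^ multiplicity p N * M" "\<not> p dvd M"
    by (rule multiplicity_decompose'[of N p]) (use \<open>N > 0\<close> p(1) in auto)
  ultimately have M: "N = p ^ 2 * M" "\<not> p dvd M" by simp_all
  have "M > 0" using M \<open>N > 0\<close> by (auto intro: Nat.gr0I)
  have "coprime (p ^ 2) M" using M(2) p(1) by (simp add: prime_imp_coprime)
  hence tot: "totient N = p * ((p - 1) * totient M)"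
    unfolding M(1) using totient_prime_power[OF p(1), of 2] by (simp add: totient_mult_coprime)
  have "\<not> p dvd totient M"
  proof
    assume "p dvd totient M"
    then obtain q where q: "prime q" "q dvd M" "p dvd q - 1"
      using prime_dvd_totientD[OF p(1) _ \<open>M > 0\<close> M(2)] by blast
    have "q dvd a * fact n" using q(2) M(1) N by (metis dvd_mult dvd_mult2)
    hence "q dvd a \<or> q dvd fact n" using q(1) by (simp add: prime_dvd_mult_iff)
    \<comment> \<open>If \<open>q dvd a\<close>, then \<open>q <= a < p <= n\<close>.\<close>
    hence "q \<le> n"
      using q(1) abc p(3) by (auto simp: prime_dvd_fact_iff dest!: dvd_imp_le)
    from q(3) obtain k where k: "q - 1 = p * k" ..
    have "q \<ge> 2" using q(1) by (rule prime_ge_2_nat)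
    have "p * k < p * 3" using k \<open>q \<le> n\<close> p(4) by linarith
    hence "k < 3" by simp
    moreover have "k \<noteq> 0" using k \<open>q \<ge> 2\<close> by (intro notI) simp
    ultimately consider "k = 1" | "k = 2" by linarith
    thus False
    proof cases
      case 1
      hence "q = p + 1" using k \<open>q \<ge> 2\<close> by simp
      moreover have "odd p" using p(1,2) primes_dvd_imp_eq two_is_prime_nat by blast
      ultimately have "even q" by simp
      hence "q = 2" using q(1) primes_dvd_imp_eq two_is_prime_nat by blast
      thus False using \<open>q = p + 1\<close> p(1) by simp
    next
      case 2
      hence "q = 2 * p + 1" using k \<open>q \<ge> 2\<close> by simp
      thus False using p(5) q(1) \<open>q \<le> n\<close> by simp
    qed
  qed
  moreover have "\<not> p dvd p - 1" using prime_ge_2_nat[OF p(1)] by (intro not_dvd) auto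
  ultimately have nd: "\<not> p dvd (p - 1) * totient M" using p(1) by (simp add: prime_dvd_mult_iff)
  have "p dvd c * x ^ m" using eq tot by (simp add: N_def)
  hence "p dvd x"
    using not_dvd[OF abc(5,6)] p(1) by (auto simp: prime_dvd_mult_iff dest: prime_dvd_power)
  hence "p ^ 2 dvd x ^ m" using m by (metis dvd_power_same le_imp_power_dvd dvd_trans)
  hence "p ^ 2 dvd totient N" using eq by (simp add: N_def)
  hence "p * p dvd p * ((p - 1) * totient M)" unfolding tot power2_eq_square .
  thus False using nd p(1) by (simp add: prime_gt_0_nat)
qed

section \<open>Evaluating totients of factorials\<close>

text \<open>The ratio of \<open>totient b\<close> to \<open>b\<close> depends only on the set of
  primes dividing \<open>b\<close>.\<close>

lemma totient_mult_of_prime_factors_subset: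
  assumes "\<And>p. prime p \<Longrightarrow> p dvd a \<Longrightarrow> p dvd b" "a > 0"
  shows "totient (a * b) = a * totient b"
proof (cases "b = 0")
  case False
  have "prime_factors (a * b) = prime_factors b"
    using assms False by (auto simp: in_prime_factors_iff prime_dvd_mult_iff)
  hence "real (totient (a * b)) = real (a * totient b)"
    by (simp add: totient_formula2 mult.assoc)
  thus ?thesis by (simp only: of_nat_eq_iff)
qed simp

text \<open>A prime \<open>Suc n\<close> is coprime to \<open>fact n\<close>; otherwise all its
  prime factors already divide \<open>fact n\<close>.\<close>

lemma totient_fact_Suc:
  "totient (fact (Suc n)) = (if prime (Suc n) then n else Suc n) * totient (fact n)"
proof (cases "prime (Suc n)")
  case True
  have "coprime (Suc n) (fact n)"
    using True by (intro prime_imp_coprime) (auto simp: prime_dvd_fact_iff)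
  hence "totient (Suc n * fact n) = totient (Suc n) * totient (fact n)"
    by (rule totient_mult_coprime)
  thus ?thesis using True by (simp add: totient_prime del: mult_Suc)
next
  case False
  have "p dvd fact n" if "prime p" "p dvd Suc n" for p
  proof -
    have "p \<noteq> Suc n" using False that by auto
    hence "p \<le> n" using dvd_imp_le[OF that(2)] by simp
    thus ?thesis using that by (simp add: prime_dvd_fact_iff)
  qed
  thus ?thesis using False totient_mult_of_prime_factors_subset[of "Suc n" "fact n"]
    by (simp del: mult_Suc)
qed

lemma totient_fact_numeral:
  "totient (fact (numeral k)) =
    (if prime (numeral k :: nat) then pred_numeral k else numeral k) * totient (fact (pred_numeral k))"
  using totient_fact_Suc[of "pred_numeral k"] by (simp only: numeral_eq_Suc[symmetric])

text \<open>The multiplicity of \<open>p\<close> in \<open>y ^ m\<close> is \<open>m\<close> times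
  that in \<open>y\<close>. The exact exponent is given by two divisibilities, which can be decided
  on numerals.\<close>

lemma perfect_power_imp_dvd_exponent:
  fixes v y m p e :: nat
  assumes "v = y ^ m" "m > 0" "prime p" "p ^ e dvd v" "\<not> p ^ Suc e dvd v"
  shows "m dvd e"
proof -
  have "v \<noteq> 0" using assms(5) by (metis dvd_0_right)
  hence "y \<noteq> 0" using assms(1,2) by auto
  have "e = multiplicity p v" using assms(4,5) by (rule multiplicity_eqI[symmetric])
  also have "\<dots> = m * multiplicity p y"
    unfolding assms(1) using assms(3) \<open>y \<noteq> 0\<close> by (simp add: prime_elem_multiplicity_power_distrib)
  finally show ?thesis by simp
qed

section \<open>The bound on \<open>n\<close> and the list of perfect powers\<close>

lemma totient_fact_quotient_power_bound:
  fixes a b c m n x :: nat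
  assumes "a > 0" "b > 0" "c > 0" "m \<ge> 2" "b dvd a * fact n" "totient (a * fact n div b) = c * x ^ m"
  shows "n \<le> Max {61, 3 * a, 3 * b, 3 * c}"
proof (rule ccontr)
  assume "\<not> ?thesis"
  hence n: "n \<ge> 62" "3 * a < n" "3 * b < n" "3 * c < n" by auto
  obtain p where p: "prime p" "p mod 3 = 1" "2 * p \<le> n" "n < 3 * p"
    using exists_prime_1_mod_3[OF n(1)] by blast
  have "3 dvd 2 * p + 1" using p(2) by presburger
  hence "\<not> prime (2 * p + 1)" using p(3,4) n(1) by (auto simp: prime_nat_iff)
  moreover have "p \<noteq> 2" using p(2) by auto
  ultimately show False
    using totient_fact_quotient_not_power[of p n a b c m x] p n assms by auto
qed

lemma totient_fact_eq_power_cases: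
  fixes n m y :: nat
  assumes "n \<ge> 1" "m \<ge> 2" and eq: "totient (fact n) = y ^ m"
  shows "n = 1 \<or> n = 2 \<or> n = 4 \<and> m = 3 \<or> n = 5 \<and> m = 5 \<or> m = 2 \<and> n \<in> {8, 9, 11, 13}"
proof -
  have E: "m dvd e" if "prime p" "p ^ e dvd totient (fact n)" "\<not> p ^ Suc e dvd totient (fact n)" for p e
    using perfect_power_imp_dvd_exponent[OF eq _ that] assms(2) by simp
  have coprime_False: False if "m dvd e" "m dvd f" "coprime e f" for e f
    using coprime_common_divisor_nat[OF that(3,1,2)] assms(2) by simp
  have m_eq: "m = q" if "m dvd q" "prime q" for q
    using prime_nat_iff[of q] that assms(2) by auto
  have K: False if "prime p" "p \<noteq> 2" "2 * p \<le> n" "n < 3 * p" "\<not> prime (2 * p + 1) \<or> n < 2 * p + 1" for p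
    using totient_fact_quotient_not_power[of p n 1 1 1 m y] that assms(2) eq prime_gt_1_nat[of p] by auto
  have "n \<le> 61"
    using totient_fact_quotient_power_bound[of 1 1 1 m n y] assms by simp
  \<comment> \<open>A prime \<open>p\<close> excludes all \<open>n\<close> in
    \<open>[2 * p, 3 * p)\<close> if \<open>2 * p + 1\<close> is composite, and only
    \<open>n = 2 * p\<close> if it is prime.\<close>
  moreover have "n \<noteq> 6" using K[of 3] by auto
  moreover have "n \<noteq> 10" using K[of 5] by auto
  moreover have "\<not> (14 \<le> n \<and> n \<le> 20)" using K[of 7] by auto
  moreover have "n \<noteq> 22" using K[of 11] by auto
  moreover have "\<not> (26 \<le> n \<and> n \<le> 38)" using K[of 13] by auto
  moreover have "\<not> (34 \<le> n \<and> n \<le> 50)" using K[of 17] by auto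
  moreover have "\<not> (38 \<le> n \<and> n \<le> 56)" using K[of 19] by auto
  moreover have "n \<noteq> 58" using K[of 29] by auto
  ultimately have "n = 0 \<or> n \<in> {1, 2, 3, 4, 5, 7, 8, 9, 11, 12, 13, 21, 23, 24, 25, 57, 59, 60, 61}"
    unfolding insert_iff empty_iff by presburger
  moreover have "n \<noteq> 3"
    using E[of 2 1] assms(2) by (auto simp: totient_fact_numeral)
  \<comment> \<open>From here on, each excluded totient contains two primes with coprime exponents,
    both divisible by \<open>m\<close>.\<close>
  moreover have "n \<noteq> 7"
  proof
    assume n: "n = 7"
    have "m dvd 2" by (rule E[of 3]) (simp_all add: n totient_fact_numeral)
    moreover have "m dvd 7" by (rule E[of 2]) (simp_all add: n totient_fact_numeral)
    ultimately show False by (rule coprime_False) simp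
  qed
  moreover have "n \<noteq> 12"
  proof
    assume n: "n = 12"
    have "m dvd 2" by (rule E[of 5]) (simp_all add: n totient_fact_numeral)
    moreover have "m dvd 5" by (rule E[of 3]) (simp_all add: n totient_fact_numeral)
    ultimately show False by (rule coprime_False) simp
  qed
  moreover have "n \<noteq> 21"
  proof
    assume n: "n = 21"
    have "m dvd 2" by (rule E[of 7]) (simp_all add: n totient_fact_numeral)
    moreover have "m dvd 29" by (rule E[of 2]) (simp_all add: n totient_fact_numeral)
    ultimately show False by (rule coprime_False) simp
  qed
  moreover have "n \<noteq> 23"
  proof
    assume n: "n = 23"
    have "m dvd 2" by (rule E[of 11]) (simp_all add: n totient_fact_numeral)
    moreover have "m dvd 31" by (rule E[of 2]) (simp_all add: n totient_fact_numeral)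
    ultimately show False by (rule coprime_False) simp
  qed
  moreover have "n \<noteq> 24"
  proof
    assume n: "n = 24"
    have "m dvd 2" by (rule E[of 11]) (simp_all add: n totient_fact_numeral)
    moreover have "m dvd 13" by (rule E[of 3]) (simp_all add: n totient_fact_numeral)
    ultimately show False by (rule coprime_False) simp
  qed
  moreover have "n \<noteq> 25"
  proof
    assume n: "n = 25"
    have "m dvd 2" by (rule E[of 11]) (simp_all add: n totient_fact_numeral)
    moreover have "m dvd 13" by (rule E[of 3]) (simp_all add: n totient_fact_numeral)
    ultimately show False by (rule coprime_False) simp
  qed
  moreover have "n \<noteq> 57"
  proof
    assume n: "n = 57"
    have "m dvd 2" by (rule E[of 23]) (simp_all add: n totient_fact_numeral)
    moreover have "m dvd 5" by (rule E[of 11]) (simp_all add: n totient_fact_numeral)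
    ultimately show False by (rule coprime_False) simp
  qed
  moreover have "n \<noteq> 59"
  proof
    assume n: "n = 59"
    have "m dvd 2" by (rule E[of 29]) (simp_all add: n totient_fact_numeral)
    moreover have "m dvd 5" by (rule E[of 11]) (simp_all add: n totient_fact_numeral)
    ultimately show False by (rule coprime_False) simp
  qed
  moreover have "n \<noteq> 60"
  proof
    assume n: "n = 60"
    have "m dvd 2" by (rule E[of 29]) (simp_all add: n totient_fact_numeral)
    moreover have "m dvd 5" by (rule E[of 11]) (simp_all add: n totient_fact_numeral)
    ultimately show False by (rule coprime_False) simp
  qed
  moreover have "n \<noteq> 61"
  proof
    assume n: "n = 61"
    have "m dvd 2" by (rule E[of 29]) (simp_all add: n totient_fact_numeral)
    moreover have "m dvd 5" by (rule E[of 11]) (simp_all add: n totient_fact_numeral)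
    ultimately show False by (rule coprime_False) simp
  qed
  \<comment> \<open>For these \<open>n\<close>, except 9, some prime occurs in the totient with a
    prime exponent, which \<open>m\<close> must equal.\<close>
  moreover have "m = 3" if "n = 4"
    using E[of 2 3] m_eq[of 3] that by (auto simp: totient_fact_numeral)
  moreover have "m = 5" if "n = 5"
    using E[of 2 5] m_eq[of 5] that by (auto simp: totient_fact_numeral)
  moreover have "m = 2" if "n \<in> {8, 11, 13}"
    using E[of 3 2] E[of 5 2] m_eq[of 2] that by (auto simp: totient_fact_numeral)
  moreover have "m = 2" if "n = 9"
  proof -
    have "m dvd 10" "m dvd 4" using E[of 2 10] E[of 3 4] that by (auto simp: totient_fact_numeral)
    \<comment> \<open>The totient is \<open>2 ^ 10 * 3 ^ 4\<close>; this difference is the gcd 2 of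
      the exponents.\<close>
    hence "m dvd 10 - 2 * 4" by (intro dvd_diff_nat dvd_mult)
    thus ?thesis by (intro m_eq) auto
  qed
  ultimately show ?thesis using assms(1) by auto
qed

theorem theorem2:
  "(\<forall>a b c m :: nat. a > 0 \<and> b > 0 \<and> c > 0 \<and> m \<ge> 2 \<and> gcd a b = 1 \<longrightarrow>
      finite {(n :: nat, x :: nat). n > 0 \<and> x > 0 \<and> b dvd a * fact n
                 \<and> totient (a * fact n div b) = c * x ^ m} \<and>
      (\<forall>n x :: nat. n > 0 \<and> x > 0 \<and> b dvd a * fact n
                 \<and> totient (a * fact n div b) = c * x ^ m
           \<longrightarrow> n \<le> Max {61, 3 * a, 3 * b, 3 * c}))
   \<and>
   (\<forall>(n :: nat) (m :: nat) (x :: int). n \<ge> 1 \<and> m \<ge> 2 \<longrightarrow>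
      (int (totient (fact n)) = x ^ m \<longleftrightarrow>
         (n = 1 \<and> (x = 1 \<or> x = -1 \<and> even m)) \<or>
         (n = 2 \<and> (x = 1 \<or> x = -1 \<and> even m)) \<or>
         (n = 4 \<and> m = 3 \<and> x = 2) \<or>
         (n = 5 \<and> m = 5 \<and> x = 2) \<or>
         (n = 8 \<and> m = 2 \<and> \<bar>x\<bar> = 2 ^ 5 * 3) \<or>
         (n = 9 \<and> m = 2 \<and> \<bar>x\<bar> = 2 ^ 5 * 3 ^ 2) \<or>
         (n = 11 \<and> m = 2 \<and> \<bar>x\<bar> = 2 ^ 6 * 3 ^ 2 * 5) \<or>
         (n = 13 \<and> m = 2 \<and> \<bar>x\<bar> = 2 ^ 8 * 3 ^ 3 * 5)))"
proof (intro conjI allI impI; (elim conjE)?)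
  fix a b c m n x :: nat
  assume "a > 0" "b > 0" "c > 0" "m \<ge> 2" "b dvd a * fact n" "totient (a * fact n div b) = c * x ^ m"
  thus "n \<le> Max {61, 3 * a, 3 * b, 3 * c}" by (rule totient_fact_quotient_power_bound)
next
  fix a b c m :: nat
  assume abcm: "a > 0" "b > 0" "c > 0" "m \<ge> 2"
  define B where "B = Max {61, 3 * a, 3 * b, 3 * c}"
  \<comment> \<open>Finiteness also needs a bound for \<open>x\<close>, obtained from
    \<open>x <= c * x ^ m\<close> and the trivial bound for the totient.\<close>
  have "n \<le> B \<and> x \<le> a * fact B"
    if "b dvd a * fact n" "totient (a * fact n div b) = c * x ^ m" for n x
  proof
    show "n \<le> B" unfolding B_def using totient_fact_quotient_power_bound[OF abcm that] .
    have "x \<le> x ^ m" using abcm(4) by (cases "x = 0") (auto intro: self_le_power)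
    also have "\<dots> \<le> c * x ^ m" using abcm(3) by simp
    also have "\<dots> \<le> a * fact n" using that(2) totient_le[of "a * fact n div b"] div_le_dividend[of "a * fact n" b]
      by linarith
    also have "\<dots> \<le> a * fact B" using \<open>n \<le> B\<close> by (intro mult_le_mono fact_mono) auto
    finally show "x \<le> a * fact B" .
  qed
  hence "{(n, x). n > 0 \<and> x > 0 \<and> b dvd a * fact n \<and> totient (a * fact n div b) = c * x ^ m}
    \<subseteq> {..B} \<times> {..a * fact B}" by auto
  thus "finite {(n, x). n > 0 \<and> x > 0 \<and> b dvd a * fact n \<and> totient (a * fact n div b) = c * x ^ m}"
    by (rule finite_subset) auto
next
  fix n m :: nat and x :: int
  assume nm: "n \<ge> 1" "m \<ge> 2"
  \<comment> \<open>For the odd exponents 3 and 5 the sign of \<open>x\<close> is forced, unlike in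
    the even case.\<close>
  have cube: "x = 2" if "x ^ k = 2 ^ k" "odd k" for k
    using that by (metis odd_pos power_eq_iff_eq_base zero_le_numeral zero_le_odd_power zero_le_power)
  have unit: "x ^ m = 1 \<longleftrightarrow> x = 1 \<or> x = -1 \<and> even m"
  proof
    assume "x ^ m = 1"
    hence "\<bar>x\<bar> ^ m = 1" by (simp flip: power_abs)
    hence "\<bar>x\<bar> = 1" using nm(2) power_eq_iff_eq_base[of m "\<bar>x\<bar>" 1] by simp
    thus "x = 1 \<or> x = -1 \<and> even m" using \<open>x ^ m = 1\<close> by (cases "even m") (auto simp: abs_if split: if_splits)
  qed auto
  have sq: "x ^ 2 = int k ^ 2 \<longleftrightarrow> \<bar>x\<bar> = int k" for k
    by (metis abs_of_nat power2_abs power2_eq_iff_nonneg abs_ge_zero of_nat_0_le_iff)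
  have dest: "n = 1 \<or> n = 2 \<or> n = 4 \<and> m = 3 \<or> n = 5 \<and> m = 5 \<or> m = 2 \<and> n \<in> {8, 9, 11, 13}"
    if "int (totient (fact n)) = x ^ m"
  proof (rule totient_fact_eq_power_cases[OF nm])
    \<comment> \<open>The totient is nonnegative, so \<open>x\<close> may be replaced by its
      absolute value to reach the natural-number case.\<close>
    have "int (totient (fact n)) = \<bar>x\<bar> ^ m" using that by (metis abs_of_nat power_abs)
    thus "totient (fact n) = nat \<bar>x\<bar> ^ m" by (metis abs_ge_zero nat_int nat_power_eq)
  qed
  have v1: "int (totient (fact n)) = 1" if "n = 1 \<or> n = 2"
    using that by (auto simp: totient_fact_numeral)
  have v45: "int (totient (fact 4)) = 2 ^ 3" "int (totient (fact 5)) = 2 ^ 5"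
    by (simp_all add: totient_fact_numeral)
  have v: "int (totient (fact 8)) = int (2 ^ 5 * 3) ^ 2" "int (totient (fact 9)) = int (2 ^ 5 * 3 ^ 2) ^ 2"
    "int (totient (fact 11)) = int (2 ^ 6 * 3 ^ 2 * 5) ^ 2" "int (totient (fact 13)) = int (2 ^ 8 * 3 ^ 3 * 5) ^ 2"
    by (simp_all add: totient_fact_numeral)
  have sq': "int (totient (fact 8)) = x ^ 2 \<longleftrightarrow> \<bar>x\<bar> = 2 ^ 5 * 3"
    "int (totient (fact 9)) = x ^ 2 \<longleftrightarrow> \<bar>x\<bar> = 2 ^ 5 * 3 ^ 2"
    "int (totient (fact 11)) = x ^ 2 \<longleftrightarrow> \<bar>x\<bar> = 2 ^ 6 * 3 ^ 2 * 5"
    "int (totient (fact 13)) = x ^ 2 \<longleftrightarrow> \<bar>x\<bar> = 2 ^ 8 * 3 ^ 3 * 5"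
    unfolding v by (subst eq_commute, subst sq, simp)+
  have odd': "int (totient (fact 4)) = x ^ 3 \<longleftrightarrow> x = 2" "int (totient (fact 5)) = x ^ 5 \<longleftrightarrow> x = 2"
    using cube[of 3] cube[of 5] unfolding v45 by auto
  have unit': "int (totient (fact n)) = x ^ m \<longleftrightarrow> x = 1 \<or> x = -1 \<and> even m" if "n = 1 \<or> n = 2"
    unfolding v1[OF that] unit[symmetric] by (rule eq_commute)
  let ?RHS = "(n = 1 \<and> (x = 1 \<or> x = -1 \<and> even m)) \<or>
         (n = 2 \<and> (x = 1 \<or> x = -1 \<and> even m)) \<or>
         (n = 4 \<and> m = 3 \<and> x = 2) \<or>
         (n = 5 \<and> m = 5 \<and> x = 2) \<or>
         (n = 8 \<and> m = 2 \<and> \<bar>x\<bar> = 2 ^ 5 * 3) \<or>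
         (n = 9 \<and> m = 2 \<and> \<bar>x\<bar> = 2 ^ 5 * 3 ^ 2) \<or>
         (n = 11 \<and> m = 2 \<and> \<bar>x\<bar> = 2 ^ 6 * 3 ^ 2 * 5) \<or>
         (n = 13 \<and> m = 2 \<and> \<bar>x\<bar> = 2 ^ 8 * 3 ^ 3 * 5)"
  show "int (totient (fact n)) = x ^ m \<longleftrightarrow> ?RHS"
  proof
    assume eq: "int (totient (fact n)) = x ^ m"
    show ?RHS
      using dest[OF eq] eq unit' odd' sq' unfolding insert_iff empty_iff by metis
  next
    assume ?RHS
    thus "int (totient (fact n)) = x ^ m" using unit' odd' sq' by metis
  qed
qed

end
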